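(* Let $X$ be a QFS-space and let $A\subseteq X$ be a directed closed set. Then $A$, with the subspace topology, is a QFS-space.
   Context: All topological spaces are $T_0$. For a space $(X,\tau)$, order-theoretic notions refer to the specialization order: $x\le y$ iff $x\in \mathrm{cl}_\tau\{y\}$. For $A\subseteq X$, $\uparrow A=\{x:\exists a\in A,\ a\le x\}$. A directed subset $D$ of $X$ (nonempty, every two elements have an upper bound in $D$), viewed as a net indexed by itself, converges to $x$, written $D\to_\tau x$, if it is eventually in every open neighbourhood of $x$. A set $U\subseteq X$ is directed open if for every directed $D$ and every $x\in U$ with $D\to_\tau x$ one has $D\cap U\neq\emptyset$; $d(X)$ is the family of directed open sets. A set is directed closed if its complement is directed open. $X$ is a directed space if $d(X)=\tau$. $\mathcal{P}^w(X)$ is the set of nonempty finite subsets of $X$. A nonempty family $\mathcal{F}\subseteq\mathcal{P}^w(X)$ is directed if for all $F_1,F_2\in\mathcal{F}$ there is $F\in\mathcal{F}$ with $F\subseteq\uparrow F_1\cap\uparrow F_2$; a directed family $\mathcal{F}$ converges to $x$, written $\mathcal{F}\to_\tau x$, if every open neighbourhood $U$ of $x$ contains some $F\in\mathcal{F}$ as a subset. For a directed space $X$, a map $\delta:X\to\mathcal{P}^w(X)$ is quasi-finitely separating if: (i) $a\le b$ implies $\delta(b)\subseteq\uparrow\delta(a)$; (ii) there is a finite set $F_\delta\subseteq X$ such that for every $x\in X$ there is $y\in F_\delta$ with $x\in\uparrow y\subseteq\uparrow\delta(x)$; (iii) for every directed $D\subseteq X$ with $D\to_\tau x$ and every open $U$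 with $\delta(x)\subseteq U$, there is $d\in D$ with $\delta(d)\subseteq U$. A set $\mathcal{D}$ of maps $X\to\mathcal{P}^w(X)$ is directed if it is nonempty and for all $\delta_1,\delta_2\in\mathcal{D}$ there is $\delta\in\mathcal{D}$ with $\delta(x)\subseteq\uparrow\delta_1(x)\cap\uparrow\delta_2(x)$ for all $x\in X$. A quasi-approximate identity for $X$ is a directed set $\mathcal{D}$ of maps $X\to\mathcal{P}^w(X)$ such that for every $x\in X$, $\{\delta(x):\delta\in\mathcal{D}\}\to_\tau x$. A QFS-space is a directed space that has a quasi-approximate identity consisting of quasi-finitely separating maps. *)

theory Defs
  imports "HOL-Analysis.Analysis"
begin

text \<open>Spaces are abstract topologies with carrier \<^term>\<open>topspace X\<close>, so that a closed subset can
  itself be treated as a space through \<^const>\<open>subtopology\<close>. The specialization order below only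
  relates points of the carrier, because \<^term>\<open>X closure_of {y}\<close> is empty for \<open>y\<close> outside it.\<close>

definition spec_le :: "'a topology \<Rightarrow> 'a \<Rightarrow> 'a \<Rightarrow> bool" where
  "spec_le X x y \<longleftrightarrow> x \<in> X closure_of {y}"

definition up :: "'a topology \<Rightarrow> 'a set \<Rightarrow> 'a set" where
  "up X A = {x \<in> topspace X. \<exists>a\<in>A. spec_le X a x}"

definition directed_in :: "'a topology \<Rightarrow> 'a set \<Rightarrow> bool" where
  "directed_in X D \<longleftrightarrow>
     D \<subseteq> topspace X \<and> D \<noteq> {} \<and> (\<forall>a\<in>D. \<forall>b\<in>D. \<exists>c\<in>D. spec_le X a c \<and> spec_le X b c)"

definition dir_converges :: "'a topology \<Rightarrow> 'a set \<Rightarrow> 'a \<Rightarrow> bool" where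
  "dir_converges X D x \<longleftrightarrow>
     x \<in> topspace X \<and>
     (\<forall>U. openin X U \<and> x \<in> U \<longrightarrow> (\<exists>d\<in>D. \<forall>e\<in>D. spec_le X d e \<longrightarrow> e \<in> U))"

definition directed_open :: "'a topology \<Rightarrow> 'a set \<Rightarrow> bool" where
  "directed_open X U \<longleftrightarrow>
     U \<subseteq> topspace X \<and>
     (\<forall>D. \<forall>x\<in>U. directed_in X D \<and> dir_converges X D x \<longrightarrow> D \<inter> U \<noteq> {})"

definition directed_closed :: "'a topology \<Rightarrow> 'a set \<Rightarrow> bool" where
  "directed_closed X A \<longleftrightarrow> A \<subseteq> topspace X \<and> directed_open X (topspace X - A)"

definition directed_space :: "'a topology \<Rightarrow> bool" where
  "directed_space X \<longleftrightarrow> t0_space X \<and> {U. directed_open X U} = {U. openin X U}"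

definition fin_subsets :: "'a topology \<Rightarrow> 'a set set" where
  "fin_subsets X = {F. F \<subseteq> topspace X \<and> finite F \<and> F \<noteq> {}}"

definition directed_family :: "'a topology \<Rightarrow> 'a set set \<Rightarrow> bool" where
  "directed_family X \<F> \<longleftrightarrow>
     \<F> \<subseteq> fin_subsets X \<and> \<F> \<noteq> {} \<and>
     (\<forall>F1\<in>\<F>. \<forall>F2\<in>\<F>. \<exists>F\<in>\<F>. F \<subseteq> up X F1 \<inter> up X F2)"

definition family_converges :: "'a topology \<Rightarrow> 'a set set \<Rightarrow> 'a \<Rightarrow> bool" where
  "family_converges X \<F> x \<longleftrightarrow>
     directed_family X \<F> \<and> x \<in> topspace X \<and>
     (\<forall>U. openin X U \<and> x \<in> U \<longrightarrow> (\<exists>F\<in>\<F>. F \<subseteq> U))"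

text \<open>A map from the space \<open>X\<close> to its nonempty finite subsets is a HOL function whose values outside
  \<^term>\<open>topspace X\<close> are irrelevant. The finite set \<open>F\<close> in the second condition may be empty only
  if the space is.\<close>

definition quasi_finitely_separating :: "'a topology \<Rightarrow> ('a \<Rightarrow> 'a set) \<Rightarrow> bool" where
  "quasi_finitely_separating X \<delta> \<longleftrightarrow>
     \<delta> \<in> topspace X \<rightarrow> fin_subsets X \<and>
     (\<forall>a\<in>topspace X. \<forall>b\<in>topspace X. spec_le X a b \<longrightarrow> \<delta> b \<subseteq> up X (\<delta> a)) \<and>
     (\<exists>F. finite F \<and> F \<subseteq> topspace X \<and>
        (\<forall>x\<in>topspace X. \<exists>y\<in>F. x \<in> up X {y} \<and> up X {y} \<subseteq> up X (\<delta> x))) \<and>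
     (\<forall>D. \<forall>x\<in>topspace X. directed_in X D \<and> dir_converges X D x \<longrightarrow>
        (\<forall>U. openin X U \<and> \<delta> x \<subseteq> U \<longrightarrow> (\<exists>d\<in>D. \<delta> d \<subseteq> U)))"

definition directed_maps :: "'a topology \<Rightarrow> ('a \<Rightarrow> 'a set) set \<Rightarrow> bool" where
  "directed_maps X \<D> \<longleftrightarrow>
     \<D> \<subseteq> (topspace X \<rightarrow> fin_subsets X) \<and> \<D> \<noteq> {} \<and>
     (\<forall>\<delta>1\<in>\<D>. \<forall>\<delta>2\<in>\<D>. \<exists>\<delta>\<in>\<D>. \<forall>x\<in>topspace X. \<delta> x \<subseteq> up X (\<delta>1 x) \<inter> up X (\<delta>2 x))"

definition quasi_approximate_identity :: "'a topology \<Rightarrow> ('a \<Rightarrow> 'a set) set \<Rightarrow> bool" where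
  "quasi_approximate_identity X \<D> \<longleftrightarrow>
     directed_maps X \<D> \<and>
     (\<forall>x\<in>topspace X. family_converges X ((\<lambda>\<delta>. \<delta> x) ` \<D>) x)"

definition QFS_space :: "'a topology \<Rightarrow> bool" where
  "QFS_space X \<longleftrightarrow>
     directed_space X \<and>
     (\<exists>\<D>. quasi_approximate_identity X \<D> \<and> (\<forall>\<delta>\<in>\<D>. quasi_finitely_separating X \<delta>))"

end

theory Submission
  imports Defs
begin

text \<open>
  In a directed space a directed closed set \<open>A\<close> is closed, and a closed set is a lower set of the
  specialization order. Hence a quasi-finitely separating map \<open>\<delta>\<close> can be cut down to
  \<open>x \<mapsto> \<delta> x \<inter> A\<close> on \<open>A\<close>. The traces are nonempty: the separation by a finite set puts every
  \<open>x\<close> above some element of \<open>\<delta> x\<close>, and for \<open>x \<in> A\<close> that element lies in \<open>A\<close>. For the same reason nothing is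
  lost on upper sets: every point of \<open>A\<close> above \<open>S\<close> is above \<open>S \<inter> A\<close> (\<open>up_subtopology_trace\<close>), which
  transfers all the order conditions.

  Convergence of the traces to \<open>x\<close> is inherited by intersecting with \<open>A\<close>. Continuity along
  directed sets needs a device: if \<open>V\<close> is open in \<open>X\<close>, then so is \<open>V \<union> (X - A)\<close>, and a subset
  of \<open>X\<close> lies in \<open>V \<union> (X - A)\<close> exactly when its trace on \<open>A\<close> lies in \<open>V\<close>; so a statement
  about \<open>\<delta> d \<inter> A\<close> and an open set of \<open>A\<close> is a statement about \<open>\<delta> d\<close> and an open set of \<open>X\<close>.
  The same enlargement shows that \<open>A\<close> is a directed space: a directed open \<open>U\<close> of
  the subspace gives the directed open set \<open>U \<union> (X - A)\<close> of \<open>X\<close>, since a directed set converging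
  to a point of \<open>U\<close> either leaves \<open>A\<close> or converges inside \<open>A\<close>.
\<close>

lemma spec_le_subtopology:
  "spec_le (subtopology X A) x y \<longleftrightarrow> x \<in> A \<and> y \<in> A \<and> spec_le X x y"
  by (cases "y \<in> A") (auto simp: spec_le_def closure_of_subtopology)

lemma spec_le_refl: "x \<in> topspace X \<Longrightarrow> spec_le X x x"
  by (simp add: spec_le_def in_closure_of)

lemma spec_le_closedin:
  assumes "closedin X A" "spec_le X x y" "y \<in> A"
  shows "x \<in> A"
  using assms closure_of_minimal[of "{y}" A X] by (auto simp: spec_le_def)

text \<open>The witness below a point of \<open>A\<close> is itself in \<open>A\<close>, because \<open>A\<close> is a lower set.\<close>

lemma up_subtopology_trace:
  assumes "closedin X A"
  shows "up (subtopology X A) (S \<inter> A) = up X S \<inter> A"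
  using spec_le_closedin[OF assms] by (auto simp: up_def spec_le_subtopology)

lemma directed_in_subtopology:
  "directed_in (subtopology X A) D \<longleftrightarrow> directed_in X D \<and> D \<subseteq> A"
  unfolding directed_in_def spec_le_subtopology by (auto; blast)

lemma dir_converges_subtopology:
  assumes "D \<subseteq> A"
  shows "dir_converges (subtopology X A) D x \<longleftrightarrow> dir_converges X D x \<and> x \<in> A"
proof -
  have "(\<exists>d\<in>D. \<forall>e\<in>D. spec_le (subtopology X A) d e \<longrightarrow> e \<in> V \<inter> A) \<longleftrightarrow>
        (\<exists>d\<in>D. \<forall>e\<in>D. spec_le X d e \<longrightarrow> e \<in> V)" for V
    using assms by (auto simp: spec_le_subtopology subset_iff)
  moreover have "dir_converges (subtopology X A) D x \<longleftrightarrow> x \<in> topspace X \<inter> A \<and>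
      (\<forall>V. openin X V \<and> x \<in> V \<inter> A \<longrightarrow>
        (\<exists>d\<in>D. \<forall>e\<in>D. spec_le (subtopology X A) d e \<longrightarrow> e \<in> V \<inter> A))"
    unfolding dir_converges_def openin_subtopology topspace_subtopology by blast
  ultimately show ?thesis
    unfolding dir_converges_def by auto
qed

text \<open>The member past which the directed set stays in \<open>U\<close> is itself in \<open>U\<close>, by reflexivity.\<close>

lemma openin_imp_directed_open:
  assumes "openin X U"
  shows "directed_open X U"
  unfolding directed_open_def
proof (intro conjI allI ballI impI)
  show "U \<subseteq> topspace X"
    using assms by (rule openin_subset)
next
  fix D x
  assume "x \<in> U" and D: "directed_in X D \<and> dir_converges X D x"
  then obtain d where d: "d \<in> D" "\<And>e. e \<in> D \<Longrightarrow> spec_le X d e \<Longrightarrow> e \<in> U"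
    using assms by (meson dir_converges_def)
  then have "d \<in> U"
    using D by (auto simp: directed_in_def intro!: spec_le_refl)
  then show "D \<inter> U \<noteq> {}"
    using d(1) by blast
qed

lemma directed_closed_imp_closedin:
  assumes "directed_space X" "directed_closed X A"
  shows "closedin X A"
  using assms by (auto simp: directed_space_def directed_closed_def closedin_def)

text \<open>A directed set converging to a point of \<open>U\<close> may leave \<open>A\<close>, so \<open>U\<close> itself need not be
  directed open in \<open>X\<close>; adding the complement of \<open>A\<close> catches exactly those directed sets.\<close>

lemma directed_open_subtopology_Un_compl:
  assumes A: "directed_closed X A" and U: "directed_open (subtopology X A) U"
  shows "directed_open X (U \<union> (topspace X - A))"
  unfolding directed_open_def
proof (intro conjI allI ballI impI)
  show "U \<union> (topspace X - A) \<subseteq> topspace X"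
    using U by (auto simp: directed_open_def)
next
  fix D x
  assume x: "x \<in> U \<union> (topspace X - A)" and D: "directed_in X D \<and> dir_converges X D x"
  show "D \<inter> (U \<union> (topspace X - A)) \<noteq> {}"
  proof (cases "x \<in> U \<and> D \<subseteq> A")
    case True
    then have "x \<in> A"
      using U by (auto simp: directed_open_def)
    then have "directed_in (subtopology X A) D" "dir_converges (subtopology X A) D x"
      using True D by (simp_all add: directed_in_subtopology dir_converges_subtopology)
    then show ?thesis
      using U True unfolding directed_open_def by blast
  next
    case False
    then show ?thesis
    proof (cases "x \<in> U")
      case True
      with False D show ?thesis
        by (auto simp: directed_in_def)
    next
      case False
      with x D A show ?thesis
        unfolding directed_closed_def directed_open_def by blast
    qed
  qed
qed

lemma directed_space_subtopology:
  assumes X: "directed_space X" and A: "directed_closed X A"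
  shows "directed_space (subtopology X A)"
proof -
  have "openin (subtopology X A) U" if U: "directed_open (subtopology X A) U" for U
  proof -
    have "openin X (U \<union> (topspace X - A))"
      using directed_open_subtopology_Un_compl[OF A U] X by (auto simp: directed_space_def)
    moreover have "U = (U \<union> (topspace X - A)) \<inter> A"
      using U by (auto simp: directed_open_def)
    ultimately show ?thesis
      unfolding openin_subtopology by blast
  qed
  then show ?thesis
    using X by (auto simp: directed_space_def t0_space_subtopology intro: openin_imp_directed_open)
qed

lemma quasi_finitely_separating_fin_subsets:
  assumes "quasi_finitely_separating X \<delta>" "x \<in> topspace X"
  shows "\<delta> x \<in> fin_subsets X"
  using assms by (auto simp: quasi_finitely_separating_def)

lemma quasi_finitely_separating_mono:
  assumes "quasi_finitely_separating X \<delta>" "spec_le X a b" "a \<in> topspace X" "b \<in> topspace X"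
  shows "\<delta> b \<subseteq> up X (\<delta> a)"
  using assms(1)[unfolded quasi_finitely_separating_def, THEN conjunct2, THEN conjunct1] assms(2-)
  by simp

lemma quasi_finitely_separating_continuous:
  assumes "quasi_finitely_separating X \<delta>" "directed_in X D" "dir_converges X D x"
    and "openin X U" "\<delta> x \<subseteq> U"
  obtains d where "d \<in> D" "\<delta> d \<subseteq> U"
proof -
  have "x \<in> topspace X"
    using assms(3) by (simp add: dir_converges_def)
  then have "\<exists>d\<in>D. \<delta> d \<subseteq> U"
    using assms(1)[unfolded quasi_finitely_separating_def, THEN conjunct2, THEN conjunct2,
        THEN conjunct2] assms(2-)
    by simp
  then show thesis
    using that by blast
qed

text \<open>The separating point \<open>y\<close> satisfies \<open>x \<in> up X {y} \<subseteq> up X (\<delta> x)\<close>.\<close>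

lemma quasi_finitely_separating_in_up:
  assumes "quasi_finitely_separating X \<delta>" "x \<in> topspace X"
  shows "x \<in> up X (\<delta> x)"
  using assms unfolding quasi_finitely_separating_def by blast

text \<open>Nonemptiness is the point: an element of \<open>\<delta> x\<close> below \<open>x \<in> A\<close> survives in the trace.\<close>

lemma trace_in_fin_subsets:
  assumes A: "closedin X A" and \<delta>: "quasi_finitely_separating X \<delta>" and x: "x \<in> A"
  shows "\<delta> x \<inter> A \<in> fin_subsets (subtopology X A)"
proof -
  have xX: "x \<in> topspace X"
    using A x closedin_subset by blast
  then have "\<delta> x \<in> fin_subsets X"
    by (rule quasi_finitely_separating_fin_subsets[OF \<delta>])
  moreover have "x \<in> up (subtopology X A) (\<delta> x \<inter> A)"
    using quasi_finitely_separating_in_up[OF \<delta> xX] x by (simp add: up_subtopology_trace[OF A])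
  ultimately show ?thesis
    by (auto simp: fin_subsets_def up_def)
qed

lemma quasi_finitely_separating_trace:
  assumes A: "closedin X A" and \<delta>: "quasi_finitely_separating X \<delta>"
  shows "quasi_finitely_separating (subtopology X A) (\<lambda>x. \<delta> x \<inter> A)"
proof -
  have AX: "A \<subseteq> topspace X"
    using A by (rule closedin_subset)
  then have top: "topspace (subtopology X A) = A"
    by auto
  have mono: "\<delta> b \<inter> A \<subseteq> up (subtopology X A) (\<delta> a \<inter> A)"
    if "a \<in> A" "b \<in> A" "spec_le (subtopology X A) a b" for a b
  proof -
    have "\<delta> b \<subseteq> up X (\<delta> a)"
      using that AX by (intro quasi_finitely_separating_mono[OF \<delta>])
        (auto simp: spec_le_subtopology)
    then show ?thesis
      by (auto simp: up_subtopology_trace[OF A])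
  qed
  obtain F where F: "finite F" "F \<subseteq> topspace X"
    and sep: "\<And>x. x \<in> topspace X \<Longrightarrow> \<exists>y\<in>F. x \<in> up X {y} \<and> up X {y} \<subseteq> up X (\<delta> x)"
    using \<delta>[unfolded quasi_finitely_separating_def, THEN conjunct2, THEN conjunct2, THEN conjunct1]
    by (elim exE conjE) simp
  have sepA: "\<exists>y\<in>F \<inter> A. x \<in> up (subtopology X A) {y} \<and>
      up (subtopology X A) {y} \<subseteq> up (subtopology X A) (\<delta> x \<inter> A)" if x: "x \<in> A" for x
  proof -
    obtain y where y: "y \<in> F" "x \<in> up X {y}" "up X {y} \<subseteq> up X (\<delta> x)"
      using sep x AX by blast
    then have "y \<in> A"
      using spec_le_closedin[OF A _ x] by (auto simp: up_def)
    then have "up (subtopology X A) {y} = up X {y} \<inter> A"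
      using up_subtopology_trace[OF A, of "{y}"] by simp
    then show ?thesis
      using x y \<open>y \<in> A\<close> by (auto simp: up_subtopology_trace[OF A])
  qed
  have cont: "\<exists>d\<in>D. \<delta> d \<inter> A \<subseteq> U"
    if x: "x \<in> A" and D: "directed_in (subtopology X A) D" "dir_converges (subtopology X A) D x"
      and U: "openin (subtopology X A) U" "\<delta> x \<inter> A \<subseteq> U" for D x U
  proof -
    obtain V where V: "openin X V" "U = V \<inter> A"
      using U(1) by (auto simp: openin_subtopology)
    \<comment> \<open>\<open>V\<close> need not contain the points of \<open>\<delta> x\<close> outside \<open>A\<close>, so it is enlarged by all of them.\<close>
    have "openin X (V \<union> (topspace X - A))"
      using V(1) A by blast
    moreover have "\<delta> x \<in> fin_subsets X"
      using x AX by (intro quasi_finitely_separating_fin_subsets[OF \<delta>]) auto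
    then have "\<delta> x \<subseteq> V \<union> (topspace X - A)"
      using U(2) V(2) by (auto simp: fin_subsets_def)
    moreover have "directed_in X D" "dir_converges X D x"
      using D by (auto simp: directed_in_subtopology dir_converges_subtopology)
    ultimately obtain d where "d \<in> D" "\<delta> d \<subseteq> V \<union> (topspace X - A)"
      by (auto elim: quasi_finitely_separating_continuous[OF \<delta>])
    then show ?thesis
      using V(2) by blast
  qed
  show ?thesis
    unfolding quasi_finitely_separating_def top
  proof (intro conjI)
    show "\<exists>F. finite F \<and> F \<subseteq> A \<and> (\<forall>x\<in>A. \<exists>y\<in>F. x \<in> up (subtopology X A) {y} \<and>
        up (subtopology X A) {y} \<subseteq> up (subtopology X A) (\<delta> x \<inter> A))"
      using F(1) sepA by (intro exI[of _ "F \<inter> A"]) auto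
  qed (use mono cont trace_in_fin_subsets[OF A \<delta>] in auto)
qed

lemma quasi_approximate_identity_trace:
  assumes A: "closedin X A"
    and \<D>: "quasi_approximate_identity X \<D>"
    and sep: "\<forall>\<delta>\<in>\<D>. quasi_finitely_separating X \<delta>"
  shows "quasi_approximate_identity (subtopology X A) ((\<lambda>\<delta> x. \<delta> x \<inter> A) ` \<D>)"
proof -
  have AX: "A \<subseteq> topspace X"
    using A by (rule closedin_subset)
  then have top: "topspace (subtopology X A) = A"
    by auto
  have ne: "\<D> \<noteq> {}"
    using \<D> by (auto simp: quasi_approximate_identity_def directed_maps_def)
  have fin: "\<delta> x \<inter> A \<in> fin_subsets (subtopology X A)" if "\<delta> \<in> \<D>" "x \<in> A" for \<delta> x
    using trace_in_fin_subsets[OF A] sep that by blast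
  have dir: "\<exists>\<delta>\<in>\<D>. \<forall>x\<in>A. \<delta> x \<inter> A \<subseteq>
      up (subtopology X A) (\<delta>1 x \<inter> A) \<inter> up (subtopology X A) (\<delta>2 x \<inter> A)"
    if in_\<D>: "\<delta>1 \<in> \<D>" "\<delta>2 \<in> \<D>" for \<delta>1 \<delta>2
  proof -
    obtain \<delta> where "\<delta> \<in> \<D>" "\<forall>x\<in>topspace X. \<delta> x \<subseteq> up X (\<delta>1 x) \<inter> up X (\<delta>2 x)"
      using \<D>[unfolded quasi_approximate_identity_def directed_maps_def, THEN conjunct1,
          THEN conjunct2, THEN conjunct2, rule_format, OF in_\<D>]
      by blast
    then show ?thesis
      using AX by (intro bexI[of _ \<delta>]) (auto simp: up_subtopology_trace[OF A] subset_iff)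
  qed
  have conv: "\<exists>\<delta>\<in>\<D>. \<delta> x \<inter> A \<subseteq> U" if x: "x \<in> A" and U: "openin (subtopology X A) U" "x \<in> U" for x U
  proof -
    obtain V where V: "openin X V" "U = V \<inter> A"
      using U(1) by (auto simp: openin_subtopology)
    moreover have "family_converges X ((\<lambda>\<delta>. \<delta> x) ` \<D>) x"
      using \<D> x AX by (auto simp: quasi_approximate_identity_def)
    ultimately obtain \<delta> where "\<delta> \<in> \<D>" "\<delta> x \<subseteq> V"
      using U(2) by (auto simp: family_converges_def)
    then show ?thesis
      using V(2) by blast
  qed
  have "directed_maps (subtopology X A) ((\<lambda>\<delta> x. \<delta> x \<inter> A) ` \<D>)"
    unfolding directed_maps_def top using ne fin dir by (simp add: image_subset_iff)
  moreover have "family_converges (subtopology X A)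
      ((\<lambda>\<delta>. \<delta> x) ` (\<lambda>\<delta> x. \<delta> x \<inter> A) ` \<D>) x" if x: "x \<in> A" for x
  proof -
    have "\<exists>\<delta>\<in>\<D>. \<delta> x \<inter> A \<subseteq>
        up (subtopology X A) (\<delta>1 x \<inter> A) \<inter> up (subtopology X A) (\<delta>2 x \<inter> A)"
      if "\<delta>1 \<in> \<D>" "\<delta>2 \<in> \<D>" for \<delta>1 \<delta>2
      using dir[OF that] x by (elim bexE) (rule bexI, erule bspec)
    then have "directed_family (subtopology X A) ((\<lambda>\<delta>. \<delta> x) ` (\<lambda>\<delta> x. \<delta> x \<inter> A) ` \<D>)"
      unfolding directed_family_def using ne fin[OF _ x] by (simp add: image_subset_iff)
    then show ?thesis
      unfolding family_converges_def top using x conv[OF x] by simp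
  qed
  ultimately show ?thesis
    unfolding quasi_approximate_identity_def top by simp
qed

theorem theorem4p1:
  fixes X :: "'a topology" and A :: "'a set"
  assumes "QFS_space X"
    and "directed_closed X A"
  shows "QFS_space (subtopology X A)"
proof -
  obtain \<D> where X: "directed_space X" and \<D>: "quasi_approximate_identity X \<D>"
    and sep: "\<forall>\<delta>\<in>\<D>. quasi_finitely_separating X \<delta>"
    using assms(1) unfolding QFS_space_def by blast
  have A: "closedin X A"
    using X assms(2) by (rule directed_closed_imp_closedin)
  show ?thesis
    unfolding QFS_space_def
    using directed_space_subtopology[OF X assms(2)] quasi_approximate_identity_trace[OF A \<D> sep]
      quasi_finitely_separating_trace[OF A] sep
    by blast
qed

end
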